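(* There are no fully-transitive 3-orbit maniplexes; that is, if $\mathcal{M}$ is an $(n-1)$-maniplex whose automorphism group has exactly 3 orbits on flags, then there is some $i\in\{0,\dots,n-1\}$ such that $\mathrm{Aut}(\mathcal{M})$ is not transitive on the $i$-faces of $\mathcal{M}$.
   Context: An $(n-1)$-maniplex is given by a connected simple graph (flag graph), whose vertices are called flags, with a proper edge-colouring by colours $\{0,\dots,n-1\}$, each colour class a perfect matching, such that for colours $i,j$ with $|i-j|\ge2$ each component of the subgraph spanned by colours $i,j$ is a 4-cycle. Automorphisms are colour-preserving graph automorphisms. An $i$-face is a connected component of the flag graph with the $i$-edges removed. A maniplex is fully-transitive if its automorphism group is transitive on $i$-faces for every $i\in\{0,\dots,n-1\}$. *)

theory Defs
  imports Main "HOL-Combinatorics.Permutations"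
begin

text \<open>
  A simple graph is given by a (possibly infinite) set of vertices and a set of edges, each edge
  being a two-element set of vertices; the colour function is only meaningful on edges.
\<close>

record 'a coloured_graph =
  flags :: "'a set"
  edges :: "'a set set"
  colour :: "'a set \<Rightarrow> nat"

definition simple_graph :: "'a set \<Rightarrow> 'a set set \<Rightarrow> bool" where
  "simple_graph V E \<longleftrightarrow> (\<forall>e\<in>E. e \<subseteq> V \<and> card e = 2)"

definition connection :: "'a set \<Rightarrow> 'a set set \<Rightarrow> 'a rel" where
  "connection V E = {(u, v). u \<in> V \<and> v \<in> V \<and> (\<lambda>x y. {x, y} \<in> E)\<^sup>*\<^sup>* u v}"

text \<open>
  A connected component is represented by its vertex set, which determines it.
\<close>

definition components :: "'a set \<Rightarrow> 'a set set \<Rightarrow> 'a set set" where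
  "components V E = V // connection V E"

definition connected_graph :: "'a set \<Rightarrow> 'a set set \<Rightarrow> bool" where
  "connected_graph V E \<longleftrightarrow> V \<noteq> {} \<and> (\<forall>u\<in>V. \<forall>v\<in>V. (u, v) \<in> connection V E)"

definition perfect_matching :: "'a set \<Rightarrow> 'a set set \<Rightarrow> bool" where
  "perfect_matching V F \<longleftrightarrow> (\<forall>v\<in>V. \<exists>!e. e \<in> F \<and> v \<in> e)"

definition four_cycle :: "'a set \<Rightarrow> 'a set set \<Rightarrow> bool" where
  "four_cycle V E \<longleftrightarrow>
     (\<exists>a b c d. distinct [a, b, c, d] \<and> V = {a, b, c, d} \<and> E = {{a, b}, {b, c}, {c, d}, {d, a}})"

definition edges_coloured :: "('a, 'b) coloured_graph_scheme \<Rightarrow> nat set \<Rightarrow> 'a set set" where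
  "edges_coloured M I = {e \<in> edges M. colour M e \<in> I}"

definition proper_edge_colouring :: "nat \<Rightarrow> ('a, 'b) coloured_graph_scheme \<Rightarrow> bool" where
  "proper_edge_colouring n M \<longleftrightarrow>
     (\<forall>e\<in>edges M. colour M e < n) \<and>
     (\<forall>e\<in>edges M. \<forall>e'\<in>edges M. e \<noteq> e' \<and> e \<inter> e' \<noteq> {} \<longrightarrow> colour M e \<noteq> colour M e')"

text \<open>
  The parameter \<open>n\<close> is the number of colours, so that \<open>maniplex n M\<close> says that \<open>M\<close> is
  an \<open>(n - 1)\<close>-maniplex.
\<close>

definition maniplex :: "nat \<Rightarrow> ('a, 'b) coloured_graph_scheme \<Rightarrow> bool" where
  "maniplex n M \<longleftrightarrow>
     simple_graph (flags M) (edges M) \<and>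
     connected_graph (flags M) (edges M) \<and>
     proper_edge_colouring n M \<and>
     (\<forall>i<n. perfect_matching (flags M) (edges_coloured M {i})) \<and>
     (\<forall>i<n. \<forall>j<n. \<bar>int i - int j\<bar> \<ge> 2 \<longrightarrow>
        (\<forall>C\<in>components (flags M) (edges_coloured M {i, j}).
           four_cycle C {e \<in> edges_coloured M {i, j}. e \<subseteq> C}))"

text \<open>
  Automorphisms are normalised to be the identity outside the set of flags.
\<close>

definition automorphisms :: "('a, 'b) coloured_graph_scheme \<Rightarrow> ('a \<Rightarrow> 'a) set" where
  "automorphisms M =
     {f. f permutes flags M \<and>
         (\<forall>u\<in>flags M. \<forall>v\<in>flags M. {f u, f v} \<in> edges M \<longleftrightarrow> {u, v} \<in> edges M) \<and>
         (\<forall>e\<in>edges M. colour M (f ` e) = colour M e)}"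

definition flag_orbits :: "('a, 'b) coloured_graph_scheme \<Rightarrow> 'a set set" where
  "flag_orbits M = {{f u | f. f \<in> automorphisms M} | u. u \<in> flags M}"

definition faces :: "('a, 'b) coloured_graph_scheme \<Rightarrow> nat \<Rightarrow> 'a set set" where
  "faces M i = components (flags M) (edges M - edges_coloured M {i})"

definition face_transitive :: "('a, 'b) coloured_graph_scheme \<Rightarrow> nat \<Rightarrow> bool" where
  "face_transitive M i \<longleftrightarrow> (\<forall>F\<in>faces M i. \<forall>G\<in>faces M i. \<exists>f\<in>automorphisms M. f ` F = G)"

end

theory Submission imports Defs begin

text \<open>
  The \<open>i\<close>-adjacency of flags commutes with automorphisms, so it induces an involution \<open>s\<^sub>i\<close> on the
  three flag orbits; each \<open>s\<^sub>i\<close> is the identity or a transposition, and \<open>s\<^sub>i\<close>, \<open>s\<^sub>j\<close> commute when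
  \<open>\<bar>i - j\<bar> \<ge> 2\<close>. Distinct transpositions of three points do not commute, so they can only occur at
  adjacent colours; by connectedness there are at least two of them. It follows that some colour
  \<open>j\<close> is the only one moving a certain orbit \<open>c\<close>. Hence a \<open>j\<close>-face that meets \<open>c\<close> consists of flags
  of \<open>c\<close> only, and no automorphism maps it to a \<open>j\<close>-face through a flag outside \<open>c\<close>.
\<close>

section \<open>Commuting involutions on three points\<close>

lemma involution_card_3_fixed_point:
  assumes "card A = 3" and maps: "\<And>x. x \<in> A \<Longrightarrow> s x \<in> A" and inv: "\<And>x. x \<in> A \<Longrightarrow> s (s x) = x"
    and "x \<in> A" "s x \<noteq> x"
  shows "\<exists>z\<in>A. \<forall>y\<in>A. s y = y \<longleftrightarrow> y = z"
proof -
  have fin: "finite A" using assms(1) by (metis card.infinite zero_neq_numeral)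
  have "card (A - {x, s x}) = 1"
    using assms(1) maps[OF \<open>x \<in> A\<close>] \<open>x \<in> A\<close> \<open>s x \<noteq> x\<close> fin by (simp add: card_Diff_subset)
  then obtain z where z: "A - {x, s x} = {z}" by (meson card_1_singletonE)
  have zA: "z \<in> A" "z \<noteq> x" "z \<noteq> s x" using z by auto
  \<comment> \<open>Since \<open>s\<close> swaps \<open>x\<close> and \<open>s x\<close>, sending
    \<open>z\<close> into this pair would put \<open>z\<close> itself in it. The only value left for
    \<open>s z\<close> is \<open>z\<close>.\<close>
  have "s z \<noteq> x" "s z \<noteq> s x" using zA inv[OF zA(1)] inv[OF \<open>x \<in> A\<close>] by auto
  then have "s z = z" using maps[OF zA(1)] z by blast
  moreover have "y = x \<or> y = s x \<or> y = z" if "y \<in> A" for y using z that by blast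
  ultimately show ?thesis using zA inv[OF \<open>x \<in> A\<close>] \<open>s x \<noteq> x\<close> by metis
qed

text \<open>A change of value happens only between consecutive indices \<open>i\<close> and
  \<open>Suc i\<close>. If neither of them could serve as the exception \<open>j\<close>, there
  would be a witness at \<open>i + 2\<close> against \<open>i\<close> and one at
  \<open>i - 1\<close> against \<open>Suc i\<close>. Applying \<open>far\<close> to the pairs at
  distance 2 and 3 then forces \<open>\<phi> i = \<phi> (Suc i)\<close>.\<close>

lemma exceptional_index:
  fixes K :: "nat set" and \<phi> :: "nat \<Rightarrow> 'b"
  assumes far: "\<And>i j. i \<in> K \<Longrightarrow> j \<in> K \<Longrightarrow> \<bar>int i - int j\<bar> \<ge> 2 \<Longrightarrow> \<phi> i = \<phi> j"
    and "i0 \<in> K" "j0 \<in> K" "\<phi> i0 \<noteq> \<phi> j0"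
  shows "\<exists>j\<in>K. \<exists>l\<in>K. \<forall>k\<in>K. k \<noteq> j \<longrightarrow> \<phi> k = \<phi> l"
proof -
  obtain i where i: "i \<in> K" "Suc i \<in> K" "\<phi> i \<noteq> \<phi> (Suc i)"
  proof -
    have "\<not> \<bar>int i0 - int j0\<bar> \<ge> 2" "i0 \<noteq> j0" using far[of i0 j0] assms(2-4) by auto
    then have "j0 = Suc i0 \<or> i0 = Suc j0" by linarith
    then show ?thesis using that[of i0] that[of j0] assms(2-4) by auto
  qed
  show ?thesis
  proof (rule ccontr)
    assume neg: "\<not> ?thesis"
    \<comment> \<open>The failing choices are \<open>j = i\<close>, \<open>l = Suc i\<close> here
      and \<open>j = Suc i\<close>, \<open>l = i\<close> on the next line.\<close>
    obtain k where k: "k \<in> K" "k \<noteq> i" "\<phi> k \<noteq> \<phi> (Suc i)" using neg i by blast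
    obtain l where l: "l \<in> K" "l \<noteq> Suc i" "\<phi> l \<noteq> \<phi> i" using neg i by blast
    have "\<not> \<bar>int k - int (Suc i)\<bar> \<ge> 2" "k \<noteq> Suc i" using far[of k "Suc i"] k i by auto
    then have k2: "k = i + 2" using k by linarith
    have "\<not> \<bar>int l - int i\<bar> \<ge> 2" "l \<noteq> i" using far[of l i] l i by auto
    then have l2: "i = Suc l" using l by linarith
    have "\<phi> k = \<phi> i" "\<phi> l = \<phi> (Suc i)" "\<phi> k = \<phi> l"
      using far[of k i] far[of l "Suc i"] far[of k l] k l i k2 l2 by auto
    then show False using i by simp
  qed
qed

text \<open>For a colour \<open>k\<close> that moves some point, let \<open>\<phi> k\<close> be the
  one point fixed by \<open>s k\<close>. By \<open>conn\<close> the map \<open>\<phi>\<close> is not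
  constant, so \<open>exceptional_index\<close> applies, and the common value
  \<open>\<phi> l\<close> away from \<open>j\<close> serves as \<open>c\<close>.\<close>

lemma involutions_card_3:
  fixes s :: "nat \<Rightarrow> 'b \<Rightarrow> 'b"
  assumes card: "card A = 3"
    and maps: "\<And>i x. i < n \<Longrightarrow> x \<in> A \<Longrightarrow> s i x \<in> A"
    and inv: "\<And>i x. i < n \<Longrightarrow> x \<in> A \<Longrightarrow> s i (s i x) = x"
    and comm: "\<And>i j x. i < n \<Longrightarrow> j < n \<Longrightarrow> \<bar>int i - int j\<bar> \<ge> 2 \<Longrightarrow> x \<in> A \<Longrightarrow>
                 s i (s j x) = s j (s i x)"
    and conn: "\<And>x. x \<in> A \<Longrightarrow> \<exists>i<n. s i x \<noteq> x"
  shows "\<exists>j<n. \<exists>c\<in>A. \<forall>k<n. k \<noteq> j \<longrightarrow> s k c = c"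
proof -
  define K where "K = {k. k < n \<and> (\<exists>x\<in>A. s k x \<noteq> x)}"
  have "\<exists>z. z \<in> A \<and> (\<forall>y\<in>A. s k y = y \<longleftrightarrow> y = z)" if "k \<in> K" for k
    using that involution_card_3_fixed_point[of A "s k"] card maps inv unfolding K_def by blast
  then obtain \<phi> where \<phi>A: "\<And>k. k \<in> K \<Longrightarrow> \<phi> k \<in> A"
    and \<phi>: "\<And>k y. k \<in> K \<Longrightarrow> y \<in> A \<Longrightarrow> s k y = y \<longleftrightarrow> y = \<phi> k"
    by metis
  have Kn: "k < n" if "k \<in> K" for k using that K_def by blast
  have far: "\<phi> i = \<phi> j" if "i \<in> K" "j \<in> K" "\<bar>int i - int j\<bar> \<ge> 2" for i j
  proof -
    \<comment> \<open>By commutation \<open>s i\<close> also fixes \<open>s j (\<phi> i)\<close>.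
      Uniqueness of its fixed point makes \<open>s j\<close> fix \<open>\<phi> i\<close>.\<close>
    have "s i (s j (\<phi> i)) = s j (\<phi> i)"
      using comm[of i j "\<phi> i"] \<phi>[of i "\<phi> i"] \<phi>A that Kn by simp
    then have "s j (\<phi> i) = \<phi> i" using \<phi>[of i "s j (\<phi> i)"] maps \<phi>A that Kn by simp
    then show ?thesis using \<phi> \<phi>A that by blast
  qed
  have "A \<noteq> {}" using card by auto
  then obtain i0 where i0: "i0 \<in> K" using conn K_def by blast
  obtain j0 where "j0 < n" "s j0 (\<phi> i0) \<noteq> \<phi> i0" using conn \<phi>A i0 by blast
  then have "j0 \<in> K" using \<phi>A[OF i0] K_def by blast
  with \<open>s j0 (\<phi> i0) \<noteq> \<phi> i0\<close> have "\<phi> i0 \<noteq> \<phi> j0" using \<phi> \<phi>A by metis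
  obtain j l where jl: "j \<in> K" "l \<in> K" "\<And>k. k \<in> K \<Longrightarrow> k \<noteq> j \<Longrightarrow> \<phi> k = \<phi> l"
    using exceptional_index[of K \<phi> i0 j0] far i0 \<open>j0 \<in> K\<close> \<open>\<phi> i0 \<noteq> \<phi> j0\<close> by blast
  have "s k (\<phi> l) = \<phi> l" if "k < n" "k \<noteq> j" for k
  proof (cases "k \<in> K")
    case True
    then show ?thesis using jl(3)[of k] \<phi>[of k "\<phi> l"] \<phi>A[OF jl(2)] that by simp
  next
    case False
    then show ?thesis using \<phi>A[OF jl(2)] that K_def by blast
  qed
  then show ?thesis using jl Kn \<phi>A by blast
qed

section \<open>The automorphism group and its flag orbits\<close>

lemma automorphisms_permutes: "f \<in> automorphisms M \<Longrightarrow> f permutes flags M"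
  by (simp add: automorphisms_def)

lemma id_automorphisms: "id \<in> automorphisms M"
  by (simp add: automorphisms_def permutes_id)

lemma comp_automorphisms:
  assumes sg: "simple_graph (flags M) (edges M)"
    and f: "f \<in> automorphisms M" and g: "g \<in> automorphisms M"
  shows "f \<circ> g \<in> automorphisms M"
proof -
  have fl: "g u \<in> flags M" if "u \<in> flags M" for u
    using g that by (simp add: automorphisms_permutes permutes_in_image)
  have "g ` e \<in> edges M" if e: "e \<in> edges M" for e
  proof -
    obtain u v where "e = {u, v}" "u \<in> flags M" "v \<in> flags M"
      using sg e unfolding simple_graph_def by (metis card_2_iff insert_subset)
    then show ?thesis using e g unfolding automorphisms_def by auto
  qed
  then have "colour M ((f \<circ> g) ` e) = colour M e" if "e \<in> edges M" for e
    using f g that unfolding automorphisms_def image_comp[symmetric] by auto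
  then show ?thesis
    using f g fl unfolding automorphisms_def by (auto intro: permutes_compose)
qed

lemma inv_automorphisms:
  assumes sg: "simple_graph (flags M) (edges M)" and f: "f \<in> automorphisms M"
  shows "inv f \<in> automorphisms M"
proof -
  have p: "f permutes flags M" using f by (rule automorphisms_permutes)
  have fl: "inv f u \<in> flags M" if "u \<in> flags M" for u
    using p that by (simp add: permutes_inv permutes_in_image)
  have fi: "f (inv f u) = u" for u using p by (simp add: permutes_inverses)
  have edge: "{inv f u, inv f v} \<in> edges M \<longleftrightarrow> {u, v} \<in> edges M"
    if "u \<in> flags M" "v \<in> flags M" for u v
    using f fl[OF that(1)] fl[OF that(2)] fi unfolding automorphisms_def
    by (metis (mono_tags, lifting) mem_Collect_eq)
  have "colour M (inv f ` e) = colour M e" if e: "e \<in> edges M" for e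
  proof -
    obtain u v where uv: "e = {u, v}" "u \<in> flags M" "v \<in> flags M"
      using sg e unfolding simple_graph_def by (metis card_2_iff insert_subset)
    then have "{inv f u, inv f v} \<in> edges M" using edge e by simp
    then have "colour M (f ` {inv f u, inv f v}) = colour M {inv f u, inv f v}"
      using f unfolding automorphisms_def by blast
    then show ?thesis using uv fi by simp
  qed
  then show ?thesis
    using edge permutes_inv[OF p] unfolding automorphisms_def by auto
qed

definition flag_orbit :: "('a, 'b) coloured_graph_scheme \<Rightarrow> 'a \<Rightarrow> 'a set" where
  "flag_orbit M u = {f u | f. f \<in> automorphisms M}"

lemma flag_orbits_eq: "flag_orbits M = flag_orbit M ` flags M"
  unfolding flag_orbits_def flag_orbit_def by auto

lemma flag_orbit_self: "u \<in> flag_orbit M u"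
  unfolding flag_orbit_def using id_automorphisms[of M] by (auto intro: exI[of _ id])

text \<open>Precomposition with \<open>f\<close> and with \<open>inv f\<close> stays inside the
  automorphisms and gives the two inclusions.\<close>

lemma flag_orbit_image:
  assumes sg: "simple_graph (flags M) (edges M)" and f: "f \<in> automorphisms M"
  shows "flag_orbit M (f u) = flag_orbit M u"
proof
  show "flag_orbit M (f u) \<subseteq> flag_orbit M u"
    using comp_automorphisms[OF sg _ f] unfolding flag_orbit_def by (auto, metis comp_apply)
  have "g u = (g \<circ> inv f) (f u)" for g
    using automorphisms_permutes[OF f] by (simp add: permutes_inverses)
  then show "flag_orbit M u \<subseteq> flag_orbit M (f u)"
    using comp_automorphisms[OF sg _ inv_automorphisms[OF sg f]] unfolding flag_orbit_def by blast
qed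

section \<open>Adjacent flags in a maniplex\<close>

definition adjacent_flag :: "('a, 'b) coloured_graph_scheme \<Rightarrow> nat \<Rightarrow> 'a \<Rightarrow> 'a" where
  "adjacent_flag M i u = (THE v. {u, v} \<in> edges_coloured M {i})"

locale maniplex_graph =
  fixes n :: nat and M :: "('a, 'b) coloured_graph_scheme"
  assumes maniplex: "maniplex n M"
begin

lemma simple: "simple_graph (flags M) (edges M)"
  using maniplex by (simp add: maniplex_def)

lemma colour_less: "e \<in> edges M \<Longrightarrow> colour M e < n"
  using maniplex unfolding maniplex_def proper_edge_colouring_def by blast

lemma edgeD:
  assumes "{u, v} \<in> edges M"
  shows "u \<in> flags M" "v \<in> flags M" "u \<noteq> v" "colour M {u, v} < n"
proof -
  have *: "{u, v} \<subseteq> flags M \<and> card {u, v} = 2" using simple assms unfolding simple_graph_def by blast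
  then show "u \<in> flags M" "v \<in> flags M" "u \<noteq> v" by auto
  show "colour M {u, v} < n" using assms by (rule colour_less)
qed

text \<open>The matching provides one edge at \<open>u\<close>, and an edge has exactly one other
  end. This justifies the \<open>THE\<close> in \<open>adjacent_flag\<close>.\<close>

lemma ex1_adjacent:
  assumes "i < n" "u \<in> flags M"
  shows "\<exists>!v. {u, v} \<in> edges_coloured M {i}"
proof -
  have "\<exists>!e. e \<in> edges_coloured M {i} \<and> u \<in> e"
    using maniplex assms unfolding maniplex_def perfect_matching_def by blast
  then obtain e where e: "e \<in> edges_coloured M {i}" "u \<in> e"
    and uniq: "\<And>e'. e' \<in> edges_coloured M {i} \<Longrightarrow> u \<in> e' \<Longrightarrow> e' = e" by blast
  have "card e = 2" using e simple unfolding edges_coloured_def simple_graph_def by blast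
  then obtain v where v: "e = {u, v}" using e(2) by (auto simp: card_2_iff doubleton_eq_iff)
  show ?thesis
  proof
    show "{u, v} \<in> edges_coloured M {i}" using e v by simp
    show "w = v" if "{u, w} \<in> edges_coloured M {i}" for w
      using uniq[OF that] v by (auto simp: doubleton_eq_iff)
  qed
qed

lemma adjacent_flag_edge:
  "i < n \<Longrightarrow> u \<in> flags M \<Longrightarrow> {u, adjacent_flag M i u} \<in> edges_coloured M {i}"
  unfolding adjacent_flag_def by (rule theI'[OF ex1_adjacent])

lemma adjacent_flag_eqI:
  "i < n \<Longrightarrow> {u, v} \<in> edges_coloured M {i} \<Longrightarrow> adjacent_flag M i u = v"
  using ex1_adjacent[of i u] adjacent_flag_edge[of i u] edgeD(1)[of u v]
  unfolding edges_coloured_def by blast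

lemma adjacent_flag_in: "i < n \<Longrightarrow> u \<in> flags M \<Longrightarrow> adjacent_flag M i u \<in> flags M"
  using adjacent_flag_edge[of i u] edgeD(2) unfolding edges_coloured_def by blast

lemma adjacent_flag_neq: "i < n \<Longrightarrow> u \<in> flags M \<Longrightarrow> adjacent_flag M i u \<noteq> u"
  using adjacent_flag_edge[of i u] edgeD(3)[of u "adjacent_flag M i u"]
  unfolding edges_coloured_def by auto

lemma adjacent_flag_involution:
  "i < n \<Longrightarrow> u \<in> flags M \<Longrightarrow> adjacent_flag M i (adjacent_flag M i u) = u"
  using adjacent_flag_edge[of i u] by (intro adjacent_flag_eqI) (auto simp: insert_commute)

lemma adjacent_flag_colour_neq:
  "i < n \<Longrightarrow> j < n \<Longrightarrow> i \<noteq> j \<Longrightarrow> u \<in> flags M \<Longrightarrow> adjacent_flag M i u \<noteq> adjacent_flag M j u"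
  using adjacent_flag_edge[of i u] adjacent_flag_edge[of j u] unfolding edges_coloured_def by auto

text \<open>\<open>f\<close> carries the \<open>i\<close>-edge at \<open>u\<close> to an
  \<open>i\<close>-edge at \<open>f u\<close>, and there is only one.\<close>

lemma adjacent_flag_automorphism:
  assumes "i < n" "u \<in> flags M" and f: "f \<in> automorphisms M"
  shows "adjacent_flag M i (f u) = f (adjacent_flag M i u)"
proof (rule adjacent_flag_eqI[OF \<open>i < n\<close>])
  have e: "{u, adjacent_flag M i u} \<in> edges M" "colour M {u, adjacent_flag M i u} = i"
    using adjacent_flag_edge assms unfolding edges_coloured_def by auto
  have "{f u, f (adjacent_flag M i u)} \<in> edges M"
    using f e assms adjacent_flag_in unfolding automorphisms_def by blast
  moreover have "colour M (f ` {u, adjacent_flag M i u}) = i"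
    using f e unfolding automorphisms_def by fastforce
  ultimately show "{f u, f (adjacent_flag M i u)} \<in> edges_coloured M {i}"
    unfolding edges_coloured_def by simp
qed

lemma adjacent_flag_commute:
  assumes ij: "i < n" "j < n" "\<bar>int i - int j\<bar> \<ge> 2" and u: "u \<in> flags M"
  shows "adjacent_flag M i (adjacent_flag M j u) = adjacent_flag M j (adjacent_flag M i u)"
proof (rule ccontr)
  \<comment> \<open>Otherwise five distinct flags would lie in a single 4-cycle.\<close>
  let ?E = "edges_coloured M {i, j}"
  let ?C = "connection (flags M) ?E `` {u}"
  define x where x: "x = adjacent_flag M i u"
  define y where y: "y = adjacent_flag M j u"
  define p where p: "p = adjacent_flag M j x"
  define q where q: "q = adjacent_flag M i y"
  note xy = x y and pq = p q
  assume "\<not> ?thesis"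
  then have "p \<noteq> q" by (simp add: xy pq)
  have ne: "i \<noteq> j" using ij by auto
  have fl: "x \<in> flags M" "y \<in> flags M" "p \<in> flags M" "q \<in> flags M"
    unfolding xy pq using ij u by (simp_all add: adjacent_flag_in)
  have ret: "adjacent_flag M i x = u" "adjacent_flag M j y = u"
    "adjacent_flag M j p = x" "adjacent_flag M i q = y"
    using ij u fl by (simp_all add: xy pq adjacent_flag_involution adjacent_flag_in)
  have d: "x \<noteq> y" "x \<noteq> u" "y \<noteq> u" "p \<noteq> x" "q \<noteq> y"
    using adjacent_flag_neq adjacent_flag_colour_neq ij u ne fl unfolding xy pq by auto
  \<comment> \<open>Applying the adjacency that leads back from \<open>p\<close> or \<open>q\<close>
    turns each equality into one excluded by \<open>d\<close>; for instance \<open>p = u\<close>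
    would give \<open>x = y\<close>.\<close>
  have "p \<noteq> u" "q \<noteq> u" "p \<noteq> y" "q \<noteq> x" using ret d xy by metis+
  then have five: "card {u, x, y, p, q} = 5" using d \<open>p \<noteq> q\<close> by simp
  have step: "{u, x} \<in> ?E" "{u, y} \<in> ?E" "{x, p} \<in> ?E" "{y, q} \<in> ?E"
    using adjacent_flag_edge ij u fl unfolding xy pq edges_coloured_def by auto
  have rt: "(\<lambda>x y. {x, y} \<in> ?E)\<^sup>*\<^sup>* u x" "(\<lambda>x y. {x, y} \<in> ?E)\<^sup>*\<^sup>* u y"
    using step by (auto intro!: r_into_rtranclp)
  have "(\<lambda>x y. {x, y} \<in> ?E)\<^sup>*\<^sup>* u p" "(\<lambda>x y. {x, y} \<in> ?E)\<^sup>*\<^sup>* u q"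
    using rtranclp.rtrancl_into_rtrancl[OF rt(1), of p]
      rtranclp.rtrancl_into_rtrancl[OF rt(2), of q] step by auto
  then have sub: "{u, x, y, p, q} \<subseteq> ?C"
    using rt u fl unfolding connection_def by auto
  have "?C \<in> components (flags M) ?E"
    unfolding components_def using u by (rule quotientI)
  then have "four_cycle ?C {e \<in> ?E. e \<subseteq> ?C}"
    using maniplex ij unfolding maniplex_def by blast
  then have "\<exists>a b c d. ?C = {a, b, c, d}" unfolding four_cycle_def by blast
  then obtain a b c d where C: "?C = {a, b, c, d}" by blast
  have "card ?C \<le> card (set [a, b, c, d])" unfolding C by simp
  also have "\<dots> \<le> 4" using card_length[of "[a, b, c, d]"] by simp
  finally have "card ?C \<le> 4" .
  moreover have "5 \<le> card ?C" using card_mono[OF _ sub] five C by simp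
  ultimately show False by simp
qed

section \<open>The action of the colours on orbits\<close>

lemma flag_orbit_adjacent_cong:
  assumes "i < n" "u \<in> flags M" "v \<in> flag_orbit M u"
  shows "flag_orbit M (adjacent_flag M i v) = flag_orbit M (adjacent_flag M i u)"
proof -
  obtain f where "f \<in> automorphisms M" "v = f u" using assms(3) unfolding flag_orbit_def by blast
  then show ?thesis
    using assms by (simp add: adjacent_flag_automorphism flag_orbit_image[OF simple])
qed

text \<open>This is the map \<open>s\<^sub>i\<close> on orbits. On an orbit the chosen
  representative is irrelevant by \<open>flag_orbit_adjacent_cong\<close>.\<close>

definition adjacent_orbit :: "nat \<Rightarrow> 'a set \<Rightarrow> 'a set" where
  "adjacent_orbit i X = flag_orbit M (adjacent_flag M i (SOME u. u \<in> X))"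

lemma adjacent_orbit_flag_orbit:
  assumes "i < n" "u \<in> flags M"
  shows "adjacent_orbit i (flag_orbit M u) = flag_orbit M (adjacent_flag M i u)"
  unfolding adjacent_orbit_def
  by (rule flag_orbit_adjacent_cong[OF assms]) (rule someI, rule flag_orbit_self)

text \<open>Along a path in \<open>F\<close>, each edge replaces the current orbit by its image
  under the map of that colour, which is the same orbit. It is applied with \<open>F\<close> all
  edges, for connectedness, and with \<open>F\<close> the edges not coloured \<open>j\<close>, for
  \<open>j\<close>-faces.\<close>

lemma flag_orbit_invariant:
  assumes "F \<subseteq> edges M" "u \<in> flags M"
    and fixed: "\<And>e. e \<in> F \<Longrightarrow> adjacent_orbit (colour M e) (flag_orbit M u) = flag_orbit M u"
    and conn: "(\<lambda>x y. {x, y} \<in> F)\<^sup>*\<^sup>* u v"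
  shows "flag_orbit M v = flag_orbit M u"
  using conn
proof (induction rule: rtranclp_induct)
  case base
  then show ?case by simp
next
  case (step y z)
  then have e: "{y, z} \<in> edges M" using assms(1) by blast
  let ?i = "colour M {y, z}"
  have "adjacent_flag M ?i y = z"
    using e edgeD by (intro adjacent_flag_eqI) (auto simp: edges_coloured_def)
  then have "flag_orbit M z = adjacent_orbit ?i (flag_orbit M y)"
    using adjacent_orbit_flag_orbit[of ?i y] edgeD[OF e] by simp
  then show ?case using step fixed by simp
qed

lemma adjacent_orbit_moves:
  assumes u: "u \<in> flags M" and "flag_orbits M \<noteq> {flag_orbit M u}"
  shows "\<exists>i<n. adjacent_orbit i (flag_orbit M u) \<noteq> flag_orbit M u"
proof (rule ccontr)
  assume neg: "\<not> ?thesis"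
  have fixed: "adjacent_orbit (colour M e) (flag_orbit M u) = flag_orbit M u" if "e \<in> edges M" for e
    using neg that colour_less by blast
  have "flag_orbit M v = flag_orbit M u" if "v \<in> flags M" for v
  proof (rule flag_orbit_invariant[OF order_refl u fixed])
    show "(\<lambda>x y. {x, y} \<in> edges M)\<^sup>*\<^sup>* u v"
      using maniplex u that unfolding maniplex_def connected_graph_def connection_def by blast
  qed
  then show False using assms unfolding flag_orbits_eq by blast
qed

text \<open>An automorphism taking the \<open>j\<close>-face of \<open>v\<close> to that of
  \<open>u\<close> sends \<open>v\<close> to a flag reachable from \<open>u\<close> without
  \<open>j\<close>-edges. That flag lies in the orbit of \<open>u\<close>, but also in that of
  \<open>v\<close>.\<close>

lemma not_face_transitive:
  assumes u: "u \<in> flags M" and v: "v \<in> flags M" and ne: "flag_orbit M v \<noteq> flag_orbit M u"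
    and fixed: "\<And>k. k < n \<Longrightarrow> k \<noteq> j \<Longrightarrow> adjacent_orbit k (flag_orbit M u) = flag_orbit M u"
  shows "\<not> face_transitive M j"
proof
  assume trans: "face_transitive M j"
  let ?F = "edges M - edges_coloured M {j}"
  let ?R = "connection (flags M) ?F"
  have "?R `` {v} \<in> faces M j" "?R `` {u} \<in> faces M j"
    unfolding faces_def components_def using u v by (auto intro: quotientI)
  then obtain f where f: "f \<in> automorphisms M" "f ` (?R `` {v}) = ?R `` {u}"
    using trans unfolding face_transitive_def by blast
  have "v \<in> ?R `` {v}" using v unfolding connection_def by simp
  then have "f v \<in> ?R `` {u}" using f by blast
  then have conn: "(\<lambda>x y. {x, y} \<in> ?F)\<^sup>*\<^sup>* u (f v)" unfolding connection_def by simp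
  have "adjacent_orbit (colour M e) (flag_orbit M u) = flag_orbit M u" if "e \<in> ?F" for e
    using that fixed colour_less unfolding edges_coloured_def by auto
  then have "flag_orbit M (f v) = flag_orbit M u"
    using flag_orbit_invariant[OF _ u _ conn] by blast
  then show False using ne flag_orbit_image[OF simple f(1)] by simp
qed

end

theorem theorem4p3:
  fixes M :: "'a coloured_graph" and n :: nat
  assumes "maniplex n M"
    and "card (flag_orbits M) = 3"
  shows "\<exists>i<n. \<not> face_transitive M i"
proof -
  interpret maniplex_graph n M using assms(1) by unfold_locales
  have many: "flag_orbits M \<noteq> {X}" for X using assms(2) by auto
  \<comment> \<open>Here the three points are the flag orbits and \<open>s\<close> is
    \<open>adjacent_orbit\<close>; the hypothesis \<open>conn\<close> is
    \<open>adjacent_orbit_moves\<close>.\<close>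
  have "\<exists>j<n. \<exists>c\<in>flag_orbits M. \<forall>k<n. k \<noteq> j \<longrightarrow> adjacent_orbit k c = c"
    by (rule involutions_card_3[OF assms(2)])
      (auto simp: flag_orbits_eq adjacent_orbit_flag_orbit adjacent_flag_in
        adjacent_flag_involution adjacent_flag_commute
        intro!: adjacent_orbit_moves[OF _ many])
  then obtain j u where j: "j < n" and u: "u \<in> flags M"
    and fixed: "\<And>k. k < n \<Longrightarrow> k \<noteq> j \<Longrightarrow> adjacent_orbit k (flag_orbit M u) = flag_orbit M u"
    unfolding flag_orbits_eq by blast
  obtain v where v: "v \<in> flags M" "flag_orbit M v \<noteq> flag_orbit M u"
    using many[of "flag_orbit M u"] u unfolding flag_orbits_eq by blast
  show ?thesis using not_face_transitive[OF u v fixed] j by blast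
qed

end
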